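(* Let $\mathcal H$ be a Hilbert space and let $\{f_k\}_{k\in\mathbb Z}$ be a frame sequence in $\mathcal H$ whose span is an infinite-dimensional subspace. The following are equivalent: (i) $\{f_k\}_{k\in\mathbb Z}$ is linearly independent. (ii) The map $Tf_k:=f_{k+1}$, $k\in\mathbb Z$, is well-defined and extends to a linear and invertible operator $T:\operatorname{span}\{f_k\}_{k\in\mathbb Z}\to\operatorname{span}\{f_k\}_{k\in\mathbb Z}$. In the affirmative case, $\{f_k\}_{k\in\mathbb Z}=\{T^kf_0\}_{k\in\mathbb Z}$, i.e., $f_k=T^kf_0$ for all $k\in\mathbb Z$.
   Context: A sequence $\{f_k\}_{k\in\mathbb Z}$ is a frame for a Hilbert space $\mathcal K$ if there are constants $A,B>0$ with $A\|f\|^2\le\sum_{k\in\mathbb Z}|\langle f,f_k\rangle|^2\le B\|f\|^2$ for all $f\in\mathcal K$. It is a frame sequence in $\mathcal H$ if it is a frame for the Hilbert space $\overline{\operatorname{span}}\{f_k\}_{k\in\mathbb Z}\subseteq\mathcal H$. Here $\operatorname{span}$ denotes the set of finite linear combinations (not closed), linear independence means that every finite linear combination that vanishes has all coefficients zero, and "invertible" means bijective (no boundedness is assumed). For $k<0$, $T^k:=(T^{-1})^{-k}$. *)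

theory Defs
  imports "HOL-Analysis.Analysis"
begin

definition infinite_dimensional :: "('k::field \<Rightarrow> 'h::ab_group_add \<Rightarrow> 'h) \<Rightarrow> 'h set \<Rightarrow> bool" where
  "infinite_dimensional smul S \<longleftrightarrow>
     \<not> (\<exists>B. finite B \<and> \<not> module.dependent smul B \<and> module.span smul B = S)"

text \<open>
  Independence of the indexed family: unlike independence of the set \<^term>\<open>range f\<close>, this excludes
  repeated vectors.
\<close>

definition linearly_independent_family ::
    "('k::field \<Rightarrow> 'h::ab_group_add \<Rightarrow> 'h) \<Rightarrow> ('i \<Rightarrow> 'h) \<Rightarrow> bool" where
  "linearly_independent_family smul f \<longleftrightarrow>
     (\<forall>F c. finite F \<longrightarrow> (\<Sum>k\<in>F. smul (c k) (f k)) = 0 \<longrightarrow> (\<forall>k\<in>F. c k = 0))"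

text \<open>
  Operators on a subspace \<open>S\<close> are represented by total functions, of which only the values on \<open>S\<close>
  matter.
\<close>

definition linear_operator_on ::
    "('k::field \<Rightarrow> 'h::ab_group_add \<Rightarrow> 'h) \<Rightarrow> 'h set \<Rightarrow> ('h \<Rightarrow> 'h) \<Rightarrow> bool" where
  "linear_operator_on smul S T \<longleftrightarrow>
     (\<forall>x\<in>S. \<forall>y\<in>S. T (x + y) = T x + T y) \<and> (\<forall>c. \<forall>x\<in>S. T (smul c x) = smul c (T x))"

definition invertible_shift_extension ::
    "('k::field \<Rightarrow> 'h::ab_group_add \<Rightarrow> 'h) \<Rightarrow> (int \<Rightarrow> 'h) \<Rightarrow> ('h \<Rightarrow> 'h) \<Rightarrow> bool" where
  "invertible_shift_extension smul f T \<longleftrightarrow>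
     linear_operator_on smul (module.span smul (range f)) T \<and>
     bij_betw T (module.span smul (range f)) (module.span smul (range f)) \<and>
     (\<forall>k. T (f k) = f (k + 1))"

definition shift_well_defined :: "(int \<Rightarrow> 'a) \<Rightarrow> bool" where
  "shift_well_defined f \<longleftrightarrow> (\<forall>j k. f j = f k \<longrightarrow> f (j + 1) = f (k + 1))"

definition int_power_on :: "'a set \<Rightarrow> ('a \<Rightarrow> 'a) \<Rightarrow> int \<Rightarrow> 'a \<Rightarrow> 'a" where
  "int_power_on S T k = (if k \<ge> 0 then T ^^ nat k else inv_into S T ^^ nat (- k))"

text \<open>
  Hilbert spaces over the reals and over the complex numbers are treated uniformly.  By Mazur's
  theorem a \<^class>\<open>real_normed_field\<close> is a copy of one of these two fields, and the two axioms
  below determine the conjugation: the identity on the reals, \<^const>\<open>cnj\<close> on the complex numbers.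
\<close>

class scalar_field = real_normed_field +
  fixes scalar_cnj :: "'a \<Rightarrow> 'a"
  assumes scalar_cnj_zero: "scalar_cnj 0 = 0"
    and mult_scalar_cnj: "x * scalar_cnj x = (norm x)\<^sup>2 *\<^sub>R 1"

instantiation real :: scalar_field
begin
definition scalar_cnj_real :: "real \<Rightarrow> real" where "scalar_cnj_real x = x"
instance by standard (simp_all add: scalar_cnj_real_def power2_eq_square)
end

instantiation complex :: scalar_field
begin
definition scalar_cnj_complex :: "complex \<Rightarrow> complex" where "scalar_cnj_complex = cnj"
instance by standard (simp_all add: scalar_cnj_complex_def complex_norm_square scaleR_conv_of_real
      flip: of_real_power)
end

text \<open>
  The norm, the topology and completeness are those of the type class \<^class>\<open>banach\<close>; the last two
  axioms tie them to the scalar multiplication and the inner product.  The inner product is linear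
  in the first argument.
\<close>

locale hilbert_space = vector_space smul
  for smul :: "'k::scalar_field \<Rightarrow> 'h::banach \<Rightarrow> 'h" +
  fixes ip :: "'h \<Rightarrow> 'h \<Rightarrow> 'k"
  assumes ip_add_left: "ip (x + y) z = ip x z + ip y z"
    and ip_scale_left: "ip (smul c x) y = c * ip x y"
    and ip_commute: "ip y x = scalar_cnj (ip x y)"
    and ip_self: "ip x x = of_real ((norm x)\<^sup>2)"
    and scale_of_real: "smul (of_real r) x = r *\<^sub>R x"
begin

definition frame_for :: "(int \<Rightarrow> 'h) \<Rightarrow> 'h set \<Rightarrow> bool" where
  "frame_for f K \<longleftrightarrow> range f \<subseteq> K \<and>
     (\<exists>A>0. \<exists>B>0. \<forall>g\<in>K.
        (\<lambda>k. (norm (ip g (f k)))\<^sup>2) summable_on UNIV \<and>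
        A * (norm g)\<^sup>2 \<le> (\<Sum>\<^sub>\<infinity>k. (norm (ip g (f k)))\<^sup>2) \<and>
        (\<Sum>\<^sub>\<infinity>k. (norm (ip g (f k)))\<^sup>2) \<le> B * (norm g)\<^sup>2)"

definition frame_sequence :: "(int \<Rightarrow> 'h) \<Rightarrow> bool" where
  "frame_sequence f \<longleftrightarrow> frame_for f (closure (span (range f)))"

end

lemma hilbert_space_real: "hilbert_space scaleR (inner :: 'a::{real_inner, banach} \<Rightarrow> 'a \<Rightarrow> real)"
  by unfold_locales
    (simp_all add: scalar_cnj_real_def algebra_simps inner_commute power2_norm_eq_inner)

lemma hilbert_space_complex: "hilbert_space (*) (\<lambda>x y::complex. x * cnj y)"
  by unfold_locales
    (simp_all add: scalar_cnj_complex_def algebra_simps complex_norm_square scaleR_conv_of_real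
      flip: of_real_power)

end

theory Submission
  imports Defs
begin

text \<open>
  If the family is independent, the shift and the backward shift extend linearly to its span
  and are inverse to each other. Conversely, injectivity of the operator lets a vanishing linear
  combination of the family be shifted in both directions. If the least and the greatest index of
  a nontrivial relation are \<open>m\<close> and \<open>n\<close>, every \<open>f k\<close> therefore lies in the span of the
  finitely many vectors \<open>f m, \<dots>, f (n - 1)\<close>, against infinite dimension.
\<close>

text \<open>The downward step goes from \<open>i + 1\<close> to \<open>i\<close>, the form in which
  injectivity cancels one application of an operator.\<close>

lemma int_up_down_induct [case_names base up down]:
  fixes k :: int
  assumes "P 0" "\<And>i. P i \<Longrightarrow> P (i + 1)" "\<And>i. P (i + 1) \<Longrightarrow> P i"
  shows "P k"
proof (induction k rule: int_induct[of _ 0])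
  case (step2 i)
  then show ?case using assms(3)[of "i - 1"] by simp
qed (auto intro: assms(1,2))

text \<open>Since \<open>T\<close> is injective on \<open>S\<close> and every \<open>f k\<close>
  lies in \<open>S\<close>, \<open>inv_into S T\<close> acts on the family as the backward
  shift.\<close>

lemma int_power_on_shift:
  assumes "inj_on T S" "range f \<subseteq> S" "\<And>k. T (f k) = f (k + 1)"
  shows "int_power_on S T k (f 0) = f k"
proof -
  have forward: "(T ^^ n) (f 0) = f (int n)" for n
    by (induction n) (simp_all add: assms(3) add.commute)
  have "inv_into S T (f k) = f (k - 1)" for k
    using inv_into_f_f[OF assms(1), of "f (k - 1)"] assms(2) assms(3)[of "k - 1"] by auto
  then have "(inv_into S T ^^ n) (f 0) = f (- int n)" for n
    by (induction n) (simp_all add: minus_diff_commute)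
  with forward show ?thesis
    by (simp add: int_power_on_def)
qed

context vector_space
begin

text \<open>An independent set inside the span of a finite set is finite, so a basis chosen inside
  \<open>S\<close> would be a finite basis of \<open>S\<close>.\<close>

lemma infinite_dimensional_not_subset_finite_span:
  assumes "infinite_dimensional scale S" "subspace S" "finite A"
  shows "\<not> S \<subseteq> span A"
proof
  assume sub: "S \<subseteq> span A"
  obtain B where B: "B \<subseteq> S" "independent B" "S \<subseteq> span B"
    using maximal_independent_subset by blast
  have "finite B"
    using independent_span_bound[OF assms(3) B(2)] B(1) sub by blast
  moreover have "span B = S"
    using B(1,3) span_minimal[OF _ assms(2)] by blast
  ultimately show False
    using assms(1) B(2) unfolding infinite_dimensional_def by blast
qed

text \<open>Passes from families to sets, for which the extension theorem for linear maps is
  stated.\<close>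

lemma linearly_independent_familyD:
  assumes "linearly_independent_family scale f"
  shows "inj f" "independent (range f)"
proof -
  have coeff: "c k = 0"
    if "finite F" "(\<Sum>k\<in>F. scale (c k) (f k)) = 0" "k \<in> F" for F c k
    using assms[unfolded linearly_independent_family_def, rule_format, OF that] .
  show "inj f"
  proof (rule injI, rule ccontr)
    fix i j assume "f i = f j" and "i \<noteq> j"
    \<comment> \<open>A repeated vector yields the nontrivial relation with coefficients 1 and
      -1.\<close>
    then have "(\<Sum>k\<in>{i, j}. scale (if k = i then 1 else - 1) (f k)) = 0"
      by simp
    from coeff[OF _ this, of i] show False by simp
  qed
  show "independent (range f)"
    unfolding independent_explicit_module
  proof (intro allI impI)
    fix A u v
    assume A: "finite A" "A \<subseteq> range f" and sum0: "(\<Sum>v\<in>A. scale (u v) v) = 0" and v: "v \<in> A"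
    obtain F where F: "finite F" "A = f ` F"
      using finite_subset_image[OF A] by blast
    have "(\<Sum>k\<in>F. scale (u (f k)) (f k)) = 0"
      using sum0 inj_on_subset[OF \<open>inj f\<close>, of F] by (simp add: F(2) sum.reindex)
    from coeff[OF F(1) this] show "u v = 0"
      using v F(2) by auto
  qed
qed

text \<open>\<open>T\<close> is linear on \<open>S\<close> only, so the induction must keep each
  partial sum inside \<open>S\<close>.\<close>

lemma linear_operator_on_sum:
  assumes "linear_operator_on scale S T" "subspace S" "finite F" "\<And>k. k \<in> F \<Longrightarrow> x k \<in> S"
  shows "T (\<Sum>k\<in>F. scale (c k) (x k)) = (\<Sum>k\<in>F. scale (c k) (T (x k)))"
  using assms(3,4)
proof (induction F rule: finite_induct)
  case empty
  \<comment> \<open>Homogeneity with the scalar 0 gives \<open>T 0 = 0\<close>.\<close>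
  have "T (scale 0 0) = scale 0 (T 0)"
    using assms(1) subspace_0[OF assms(2)] unfolding linear_operator_on_def by blast
  then show ?case by simp
next
  case (insert k F)
  have "scale (c k) (x k) \<in> S" "(\<Sum>k\<in>F. scale (c k) (x k)) \<in> S"
    using insert.prems assms(2) by (auto intro: subspace_scale subspace_sum)
  then show ?case
    using insert assms(1) unfolding linear_operator_on_def by simp
qed

text \<open>Values on an independent set can be prescribed freely, and injectivity of
  \<open>f\<close> lets \<open>inv f\<close> recover the index. A general \<open>\<sigma>\<close>
  covers both shifts.\<close>

lemma ex_linear_reindex:
  assumes "linearly_independent_family scale f"
  shows "\<exists>T. Vector_Spaces.linear scale scale T \<and> (\<forall>k. T (f k) = f (\<sigma> k))"
proof -
  interpret pair: vector_space_pair scale scale ..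
  obtain T where "Vector_Spaces.linear scale scale T" "\<forall>x\<in>range f. T x = f (\<sigma> (inv f x))"
    using pair.linear_independent_extend
      [OF linearly_independent_familyD(2)[OF assms], of "\<lambda>x. f (\<sigma> (inv f x))"] by blast
  then show ?thesis
    using linearly_independent_familyD(1)[OF assms] by auto
qed

lemma invertible_shift_extension_exists:
  assumes "linearly_independent_family scale f"
  shows "\<exists>T. invertible_shift_extension scale f T"
proof -
  interpret pair: vector_space_pair scale scale ..
  obtain T where T: "Vector_Spaces.linear scale scale T" "\<And>k. T (f k) = f (k + 1)"
    using ex_linear_reindex[OF assms, of "\<lambda>k. k + 1"] by blast
  obtain R where R: "Vector_Spaces.linear scale scale R" "\<And>k. R (f k) = f (k - 1)"
    using ex_linear_reindex[OF assms, of "\<lambda>k. k - 1"] by blast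
  have maps: "U x \<in> span (range f)"
    if "Vector_Spaces.linear scale scale U" "\<And>k. U (f k) \<in> range f" "x \<in> span (range f)" for U x
    using that pair.linear_span_image[OF that(1), of "range f"] span_mono[of "U ` range f" "range f"]
    by blast
  \<comment> \<open>Two linear maps that agree on the generators, here \<open>V \<circ> U\<close>
    and the identity, agree on the span.\<close>
  have inverse: "V (U x) = x"
    if "Vector_Spaces.linear scale scale U" "Vector_Spaces.linear scale scale V"
      "\<And>k. V (U (f k)) = f k" "x \<in> span (range f)"
    for U V x
    using pair.linear_eq_on[OF Vector_Spaces.linear_compose[OF that(1,2)] linear_id that(4)] that(3)
    by auto
  have "bij_betw T (span (range f)) (span (range f))"
  proof (rule bij_betw_byWitness[where f' = R])
    show "\<forall>x\<in>span (range f). R (T x) = x" "\<forall>x\<in>span (range f). T (R x) = x"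
      by (simp_all add: inverse T R)
    show "T ` span (range f) \<subseteq> span (range f)" "R ` span (range f) \<subseteq> span (range f)"
      by (simp_all add: maps T R image_subsetI)
  qed
  then have "invertible_shift_extension scale f T"
    using T by (auto simp: invertible_shift_extension_def linear_operator_on_def
        pair.linear_add pair.linear_scale)
  then show ?thesis by blast
qed

text \<open>\<open>T\<close> maps each shifted sum to the next one. Hence zero propagates upward by
  \<open>T 0 = 0\<close> and downward by injectivity of \<open>T\<close> on the span.\<close>

lemma shift_relation:
  fixes f :: "int \<Rightarrow> 'b"
  assumes T: "invertible_shift_extension scale f T"
    and F: "finite F" "(\<Sum>k\<in>F. scale (c k) (f k)) = 0"
  shows "(\<Sum>k\<in>F. scale (c k) (f (k + j))) = 0"
proof -
  let ?S = "span (range f)"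
  have lin: "linear_operator_on scale ?S T" and inj: "inj_on T ?S"
    and Tf: "\<And>k. T (f k) = f (k + 1)"
    using T by (auto simp: invertible_shift_extension_def bij_betw_def)
  have in_S: "f k \<in> ?S" for k
    by (simp add: span_base)
  have step: "T (\<Sum>k\<in>F. scale (c k) (f (k + i))) = (\<Sum>k\<in>F. scale (c k) (f (k + (i + 1))))" for i
    using linear_operator_on_sum[OF lin subspace_span F(1), of "\<lambda>k. f (k + i)" c] in_S
    by (simp add: Tf add.assoc)
  have T0: "T 0 = 0"
    using linear_operator_on_sum[OF lin subspace_span, of "{}"] by simp
  show ?thesis
  proof (induction j rule: int_up_down_induct)
    case base
    then show ?case using F(2) by simp
  next
    case (up i)
    then show ?case using step[of i] T0 by simp
  next
    case (down i)
    have "(\<Sum>k\<in>F. scale (c k) (f (k + i))) \<in> ?S"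
      using in_S by (auto intro: span_sum span_scale)
    then show ?case
      using inj_onD[OF inj, of _ 0] step[of i] down T0 span_zero by metis
  qed
qed

lemma mem_span_of_sum_zero:
  assumes "finite F" "(\<Sum>k\<in>F. scale (c k) (x k)) = 0" "i \<in> F" "c i \<noteq> 0"
  shows "x i \<in> span (x ` (F - {i}))"
proof -
  have "scale (c i) (x i) = - (\<Sum>k\<in>F - {i}. scale (c k) (x k))"
    using assms(1-3) by (simp add: sum.remove eq_neg_iff_add_eq_0)
  also have "\<dots> \<in> span (x ` (F - {i}))"
    by (intro span_neg span_sum span_scale span_base) auto
  finally show ?thesis
    using span_scale[of "scale (c i) (x i)" _ "inverse (c i)"] assms(4) by simp
qed

text \<open>Solving a shifted relation for its last term extends the window
  \<open>{Min F..<Max F}\<close> to the right, solving for its first term extends it to the left.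
  For a singleton \<open>F\<close> the window is empty and every \<open>f k\<close>
  vanishes.\<close>

lemma shifted_relation_span_bound:
  fixes f :: "int \<Rightarrow> 'b"
  assumes "finite F" "F \<noteq> {}" "\<And>k. k \<in> F \<Longrightarrow> c k \<noteq> 0"
    and rel: "\<And>j. (\<Sum>k\<in>F. scale (c k) (f (k + j))) = 0"
  shows "f k \<in> span (f ` {Min F..<Max F})"
proof -
  define m n where "m = Min F" and "n = Max F"
  let ?W = "span (f ` {m..<n})"
  have mF: "m \<in> F" and nF: "n \<in> F" and bounds: "\<And>k. k \<in> F \<Longrightarrow> m \<le> k \<and> k \<le> n"
    using assms(1,2) by (auto simp: m_def n_def)
  have mem: "f (i + j) \<in> span ((\<lambda>k. f (k + j)) ` (F - {i}))" if "i \<in> F" for i j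
    using mem_span_of_sum_zero[OF assms(1) rel that assms(3)[OF that]] .
  have right: "f k \<in> ?W" if "m \<le> k" for k
  proof -
    have "\<forall>i. m \<le> i \<and> i < n + int d \<longrightarrow> f i \<in> ?W" for d
    proof (induction d)
      case 0
      then show ?case by (auto intro: span_base)
    next
      case (Suc d)
      \<comment> \<open>After the shift by \<open>d\<close>, all indices but the greatest lie in
        \<open>{m..<n + int d}\<close>, where the induction hypothesis applies.\<close>
      have "(\<lambda>k. f (k + int d)) ` (F - {n}) \<subseteq> ?W"
        by (intro image_subsetI Suc[rule_format]) (use bounds in force)
      then have "f (n + int d) \<in> ?W"
        using mem[OF nF, of "int d"] span_minimal subspace_span by blast
      moreover have "i < n + int (Suc d) \<longleftrightarrow> i < n + int d \<or> i = n + int d" for i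
        by auto
      ultimately show ?case
        using Suc by blast
    qed
    \<comment> \<open>The bound \<open>i < n + int d\<close> is strict, hence the extra 1.\<close>
    from this[of "nat (k - n) + 1"] show ?thesis
      using that by auto
  qed
  have left: "f k \<in> ?W" if "k < m" for k
  proof -
    \<comment> \<open>No upper bound on \<open>i\<close> is imposed, as \<open>right\<close> covers
      all indices from \<open>m\<close> on.\<close>
    have "\<forall>i. m - int d \<le> i \<longrightarrow> f i \<in> ?W" for d
    proof (induction d)
      case 0
      then show ?case using right by simp
    next
      case (Suc d)
      have "(\<lambda>k. f (k + - int (Suc d))) ` (F - {m}) \<subseteq> ?W"
        by (intro image_subsetI Suc[rule_format]) (use bounds in force)
      then have "f (m + - int (Suc d)) \<in> ?W"
        using mem[OF mF, of "- int (Suc d)"] span_minimal subspace_span by blast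
      moreover have "m - int (Suc d) \<le> i \<longleftrightarrow> m - int d \<le> i \<or> i = m + - int (Suc d)" for i
        by auto
      ultimately show ?case
        using Suc by blast
    qed
    from this[of "nat (m - k)"] show ?thesis
      using that by auto
  qed
  show ?thesis
    using left right by (cases "m \<le> k") (auto simp: m_def n_def)
qed

lemma linearly_independent_family_of_shift:
  fixes f :: "int \<Rightarrow> 'b"
  assumes inf: "infinite_dimensional scale (span (range f))"
    and T: "invertible_shift_extension scale f T"
  shows "linearly_independent_family scale f"
  unfolding linearly_independent_family_def
proof (intro allI impI, rule ccontr)
  fix F c
  assume F: "finite F" "(\<Sum>k\<in>F. scale (c k) (f k)) = 0" and nz: "\<not> (\<forall>k\<in>F. c k = 0)"
  \<comment> \<open>Zero coefficients are discarded so that the least and the greatest index carry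
    nonzero ones and can be solved for.\<close>
  define G where "G = {k \<in> F. c k \<noteq> 0}"
  have G: "finite G" "G \<noteq> {}" "\<And>k. k \<in> G \<Longrightarrow> c k \<noteq> 0"
    using F(1) nz by (auto simp: G_def)
  have "(\<Sum>k\<in>G. scale (c k) (f k)) = (\<Sum>k\<in>F. scale (c k) (f k))"
    using F(1) by (intro sum.mono_neutral_left) (auto simp: G_def)
  then have "\<And>j. (\<Sum>k\<in>G. scale (c k) (f (k + j))) = 0"
    using shift_relation[OF T G(1)] F(2) by simp
  then have "range f \<subseteq> span (f ` {Min G..<Max G})"
    using shifted_relation_span_bound[of G c f] G by blast
  then have "span (range f) \<subseteq> span (f ` {Min G..<Max G})"
    by (rule span_minimal[OF _ subspace_span])
  then show False
    using infinite_dimensional_not_subset_finite_span[OF inf subspace_span] by blast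
qed

end

theorem proposition2p1:
  fixes smul :: "'k::scalar_field \<Rightarrow> 'h::banach \<Rightarrow> 'h"
    and ip :: "'h \<Rightarrow> 'h \<Rightarrow> 'k"
    and f :: "int \<Rightarrow> 'h"
  assumes "hilbert_space smul ip"
    and "hilbert_space.frame_sequence smul ip f"
    and "infinite_dimensional smul (module.span smul (range f))"
  shows "(linearly_independent_family smul f \<longleftrightarrow>
            shift_well_defined f \<and>
            (\<exists>T. invertible_shift_extension smul f T)) \<and>
         (\<forall>T. invertible_shift_extension smul f T \<longrightarrow>
            (\<forall>k. f k = int_power_on (module.span smul (range f)) T k (f 0)))"
proof -
  interpret hilbert_space smul ip
    by (rule assms(1))
  \<comment> \<open>An independent family repeats no vector, so equal vectors have equal
    indices.\<close>
  have "shift_well_defined f" if "linearly_independent_family smul f"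
    using linearly_independent_familyD(1)[OF that] by (auto simp: shift_well_defined_def inj_eq)
  moreover have "f k = int_power_on (span (range f)) T k (f 0)"
    if "invertible_shift_extension smul f T" for T k
    using that int_power_on_shift[of T "span (range f)" f k] span_superset[of "range f"]
    by (auto simp: invertible_shift_extension_def bij_betw_def)
  ultimately show ?thesis
    using invertible_shift_extension_exists linearly_independent_family_of_shift[OF assms(3)]
    by blast
qed

end
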